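(* Let $X$ be a multigraph (multiple edges allowed) with no isolated vertices and maximum valency $\Delta$. Then the complete truncation of $X$ is class I if and only if either $\Delta$ is even, or $\Delta$ is odd and $X$ is edge-feasible.
   Context: Generalized truncation of $X$: for each edge $e=[u,v]$ of $X$ take a new edge (these new edges form a matching $M_F$, one for each edge of $X$) whose two ends are labelled $u$ and $v$ respectively. For each vertex $v$ of $X$, the cluster $\mathrm{cl}(v)$ is the set of ends labelled $v$ (so $|\mathrm{cl}(v)|=\mathrm{val}(v)$); insert an arbitrary simple graph $\mathrm{con}(v)$ (the constituent at $v$) on $\mathrm{cl}(v)$. The resulting graph $M_F\cup\bigcup_v\mathrm{con}(v)$ is a generalized truncation of $X$. It is the complete truncation if every constituent $\mathrm{con}(v)$ is the complete graph on $\mathrm{cl}(v)$. A multigraph is class I if its chromatic index (minimum number of colors in a proper edge coloring) equals its maximum valency. $X$ is edge-feasible if $\Delta$ is odd and $X$ has an edge coloring (not necessarily proper) with $\Delta$ colors such that, at every vertex of valency $\Delta$, the incident edges all receive distinct colors. *)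

theory Defs
  imports Main "HOL-Library.FuncSet"
begin

text \<open>Finite loopless multigraphs. Edges are abstract objects of type \<open>'e\<close> that carry the set of
  their two end vertices, so several edges may have the same ends.\<close>

record ('v, 'e) mgraph =
  verts :: "'v set"
  edges :: "'e set"
  ends :: "'e \<Rightarrow> 'v set"

locale multigraph =
  fixes X :: "('v, 'e) mgraph"
  assumes finite_verts: "finite (verts X)"
    and finite_edges: "finite (edges X)"
    and ends_subset: "e \<in> edges X \<Longrightarrow> ends X e \<subseteq> verts X"
    and card_ends: "e \<in> edges X \<Longrightarrow> card (ends X e) = 2"

definition incident_edges :: "('v, 'e) mgraph \<Rightarrow> 'v \<Rightarrow> 'e set" where
  "incident_edges X v = {e \<in> edges X. v \<in> ends X e}"

definition valency :: "('v, 'e) mgraph \<Rightarrow> 'v \<Rightarrow> nat" where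
  "valency X v = card (incident_edges X v)"

definition no_isolated_vertices :: "('v, 'e) mgraph \<Rightarrow> bool" where
  "no_isolated_vertices X \<longleftrightarrow> (\<forall>v \<in> verts X. valency X v \<noteq> 0)"

text \<open>Inserting \<open>0\<close> matters only for the graph without vertices, whose maximum valency is thereby
  set to \<open>0\<close>.\<close>

definition max_valency :: "('v, 'e) mgraph \<Rightarrow> nat" where
  "max_valency X = Max (insert 0 (valency X ` verts X))"

definition edge_coloring :: "('v, 'e) mgraph \<Rightarrow> nat \<Rightarrow> ('e \<Rightarrow> nat) \<Rightarrow> bool" where
  "edge_coloring X k c \<longleftrightarrow> c \<in> edges X \<rightarrow> {..<k}"

definition proper_edge_coloring :: "('v, 'e) mgraph \<Rightarrow> nat \<Rightarrow> ('e \<Rightarrow> nat) \<Rightarrow> bool" where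
  "proper_edge_coloring X k c \<longleftrightarrow>
     edge_coloring X k c \<and> (\<forall>v \<in> verts X. inj_on c (incident_edges X v))"

definition chromatic_index :: "('v, 'e) mgraph \<Rightarrow> nat" where
  "chromatic_index X = (LEAST k. \<exists>c. proper_edge_coloring X k c)"

definition class_I :: "('v, 'e) mgraph \<Rightarrow> bool" where
  "class_I X \<longleftrightarrow> chromatic_index X = max_valency X"

definition edge_feasible :: "('v, 'e) mgraph \<Rightarrow> bool" where
  "edge_feasible X \<longleftrightarrow> odd (max_valency X) \<and>
     (\<exists>c. edge_coloring X (max_valency X) c \<and>
       (\<forall>v \<in> verts X. valency X v = max_valency X \<longrightarrow> inj_on c (incident_edges X v)))"

text \<open>The pair \<open>(v, e)\<close> is the end labelled \<open>v\<close> of the new edge that replaces \<open>e\<close>.\<close>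

definition cluster :: "('v, 'e) mgraph \<Rightarrow> 'v \<Rightarrow> ('v \<times> 'e) set" where
  "cluster X v = {v} \<times> incident_edges X v"

definition matching_edge :: "('v, 'e) mgraph \<Rightarrow> 'e \<Rightarrow> ('v \<times> 'e) set" where
  "matching_edge X e = (\<lambda>v. (v, e)) ` ends X e"

definition complete_graph_edges :: "'a set \<Rightarrow> 'a set set" where
  "complete_graph_edges A = {S. S \<subseteq> A \<and> card S = 2}"

text \<open>The constituent at \<open>v\<close> is a simple graph on \<open>cluster X v\<close>, given by its edge set \<open>con v\<close>, a
  set of 2-element subsets of the cluster. A matching edge has ends with different labels and a
  constituent edge has ends with the same label, so no parallel edges are merged by taking the
  edges of a truncation to be 2-element sets.\<close>

definition gen_truncation ::
    "('v, 'e) mgraph \<Rightarrow> ('v \<Rightarrow> ('v \<times> 'e) set set) \<Rightarrow> ('v \<times> 'e, ('v \<times> 'e) set) mgraph" where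
  "gen_truncation X con =
     \<lparr> verts = (\<Union>v \<in> verts X. cluster X v),
       edges = matching_edge X ` edges X \<union> (\<Union>v \<in> verts X. con v),
       ends = (\<lambda>S. S) \<rparr>"

definition complete_truncation ::
    "('v, 'e) mgraph \<Rightarrow> ('v \<times> 'e, ('v \<times> 'e) set) mgraph" where
  "complete_truncation X = gen_truncation X (\<lambda>v. complete_graph_edges (cluster X v))"

context multigraph
begin

lemma card_cluster: "card (cluster X v) = valency X v"
  by (simp add: cluster_def valency_def card_cartesian_product)

lemma finite_cluster: "finite (cluster X v)"
  using finite_edges by (simp add: cluster_def incident_edges_def)

lemma multigraph_gen_truncation:
  assumes con: "\<And>v. v \<in> verts X \<Longrightarrow> con v \<subseteq> complete_graph_edges (cluster X v)"
  shows "multigraph (gen_truncation X con)"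
proof
  have "finite (con v)" if "v \<in> verts X" for v
    using finite_subset[OF con[OF that], unfolded complete_graph_edges_def] finite_cluster[of v] by simp
  then show "finite (edges (gen_truncation X con))"
    using finite_verts finite_edges by (simp add: gen_truncation_def)
  show "finite (verts (gen_truncation X con))"
    using finite_verts finite_cluster by (simp add: gen_truncation_def)
  fix S assume "S \<in> edges (gen_truncation X con)"
  then consider (matching) e where "e \<in> edges X" "S = matching_edge X e"
    | (constituent) v where "v \<in> verts X" "S \<in> con v"
    by (auto simp: gen_truncation_def)
  then have "S \<subseteq> (\<Union>v \<in> verts X. cluster X v) \<and> card S = 2"
  proof cases
    case matching
    then show ?thesis
      using ends_subset card_ends
      by (auto simp: matching_edge_def cluster_def incident_edges_def card_image inj_on_def)
  next
    case constituent
    then show ?thesis using con by (fastforce simp: complete_graph_edges_def)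
  qed
  then show "ends (gen_truncation X con) S \<subseteq> verts (gen_truncation X con)"
    and "card (ends (gen_truncation X con) S) = 2"
    by (simp_all add: gen_truncation_def)
qed

lemma multigraph_complete_truncation: "multigraph (complete_truncation X)"
  unfolding complete_truncation_def by (rule multigraph_gen_truncation) simp

end

end

theory Submission
  imports Defs
begin

text \<open>A proper coloring of the complete truncation with \<open>\<Delta>\<close> colors induces, through the matching, a
  coloring of the edges of \<open>X\<close>. If \<open>\<Delta>\<close> is odd and \<open>v\<close> has valency \<open>\<Delta>\<close>, every end labelled \<open>v\<close> sees all \<open>\<Delta>\<close> colors; a
  color missing on the matching edges at \<open>v\<close> would form a perfect matching of the constituent at
  \<open>v\<close>, which has odd order. So all colors occur on these \<open>\<Delta>\<close> matching edges, once each.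

  Conversely, the matching edges are colored first (all alike if \<open>\<Delta>\<close> is even, by an edge-feasible
  coloring if \<open>\<Delta>\<close> is odd), and each constituent is a complete graph on \<open>d \<le> n\<close> vertices (\<open>n = \<Delta>\<close>) to
  be colored with \<open>n\<close> colors such that vertex \<open>x\<close> misses a given color \<open>f x\<close>. This is done by
  detachment. Amalgamate all vertices into a single one that carries \<open>l j\<close> loops of color \<open>j\<close> and one
  half-edge of color \<open>f x\<close> for each \<open>x\<close>; this is possible as long as every color has at most \<open>d\<close> ends
  there, which is a matter of counting. Then split off the vertices one by one: an amalgamated
  vertex of multiplicity \<open>p\<close> passes on exactly a fraction \<open>1/p\<close> of its edges to every other vertex, of
  its loops and of its half-edges, and Hall's theorem allows this selection to use each
  color at most once and every color with \<open>p\<close> ends exactly once.\<close>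

section \<open>Balanced selections in bipartite multigraphs\<close>

text \<open>The proof is by strong induction on the number of index elements. A nonempty proper
  critical subset, where Hall's condition is tight, splits the problem in two; without one, a single
  index can be matched greedily.\<close>

lemma hall:
  fixes A :: "'i \<Rightarrow> 'a set"
  assumes "finite I" and "\<And>i. i \<in> I \<Longrightarrow> finite (A i)"
    and "\<And>J. J \<subseteq> I \<Longrightarrow> card J \<le> card (\<Union> (A ` J))"
  shows "\<exists>h. inj_on h I \<and> (\<forall>i\<in>I. h i \<in> A i)"
  using assms
proof (induction "card I" arbitrary: I A rule: less_induct)
  case less
  have fin: "finite J" if "J \<subseteq> I" for J
    using that less.prems(1) finite_subset by blast
  have finU: "finite (\<Union> (A ` J))" if "J \<subseteq> I" for J
    using fin[OF that] less.prems(2) that by blast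
  show ?case
  proof (cases "\<exists>J. J \<subset> I \<and> J \<noteq> {} \<and> card (\<Union> (A ` J)) = card J")
    case True
    then obtain J where J: "J \<subset> I" "J \<noteq> {}" "card (\<Union> (A ` J)) = card J" by blast
    have finJ: "finite J" using fin J(1) by blast
    obtain h1 where h1: "inj_on h1 J" "\<forall>i\<in>J. h1 i \<in> A i"
      using less.hyps[of J A] less.prems J(1) psubset_card_mono[OF less.prems(1) J(1)] finJ
      by (metis psubset_imp_subset subset_eq subset_trans)
    \<comment> \<open>Outside \<open>J\<close>, the values available to \<open>J\<close> are
      forbidden. Tightness of \<open>J\<close> makes Hall's condition for
      \<open>K \<union> J\<close> yield the one for \<open>K\<close>.\<close>
    define B where "B i = A i - \<Union> (A ` J)" for i
    have small: "card (I - J) < card I"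
      using J less.prems(1) by (intro psubset_card_mono) auto
    have "card K \<le> card (\<Union> (B ` K))" if K: "K \<subseteq> I - J" for K
    proof -
      have KI: "K \<subseteq> I" "K \<union> J \<subseteq> I" using K J(1) by auto
      have "card K + card J = card (K \<union> J)"
        using K fin[OF KI(1)] finJ by (subst card_Un_disjoint) auto
      also have "\<dots> \<le> card (\<Union> (A ` (K \<union> J)))"
        using less.prems(3) KI(2) by blast
      also have "\<Union> (A ` (K \<union> J)) = \<Union> (B ` K) \<union> \<Union> (A ` J)"
        by (auto simp: B_def)
      also have "card \<dots> \<le> card (\<Union> (B ` K)) + card (\<Union> (A ` J))"
        by (rule card_Un_le)
      finally show ?thesis using J(3) by simp
    qed
    then obtain h2 where h2: "inj_on h2 (I - J)" "\<forall>i\<in>I - J. h2 i \<in> B i"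
      using less.hyps[OF small, of B] less.prems(1,2) by (auto simp: B_def)
    define h where "h i = (if i \<in> J then h1 i else h2 i)" for i
    have "inj_on h I"
    proof (rule inj_onI)
      fix x y assume xy: "x \<in> I" "y \<in> I" "h x = h y"
      have "h1 a \<noteq> h2 b" if "a \<in> J" "b \<in> I - J" for a b
        using that h1(2) h2(2) unfolding B_def by (metis DiffE UN_I)
      then have "x \<in> J \<longleftrightarrow> y \<in> J"
        using xy unfolding h_def by (metis DiffI)
      then show "x = y"
        using xy h1(1) h2(1) by (auto simp: h_def inj_on_def split: if_splits)
    qed
    moreover have "\<forall>i\<in>I. h i \<in> A i"
      using h1(2) h2(2) by (auto simp: h_def B_def)
    ultimately show ?thesis by blast
  next
    case False
    show ?thesis
    proof (cases "I = {}")
      case False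
      then obtain i where i: "i \<in> I" by blast
      have "card {i} \<le> card (\<Union> (A ` {i}))" using less.prems(3) i by blast
      then obtain y where y: "y \<in> A i" by fastforce
      \<comment> \<open>With no critical subset, every nonempty \<open>K\<close> avoiding
        \<open>i\<close> has a surplus of at least one value, so deleting \<open>y\<close> does no
        harm.\<close>
      define B where "B k = A k - {y}" for k
      have hallB: "card K \<le> card (\<Union> (B ` K))" if K: "K \<subseteq> I - {i}" for K
      proof (cases "K = {}")
        case False
        have KI: "K \<subseteq> I" "K \<subset> I" using K i by auto
        have "card K < card (\<Union> (A ` K))"
          using less.prems(3)[OF KI(1)] KI(2) False \<open>\<not> (\<exists>J. _ J)\<close> by (metis le_neq_implies_less)
        moreover have "\<Union> (B ` K) = \<Union> (A ` K) - {y}" by (auto simp: B_def)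
        ultimately show ?thesis
          using finU[OF KI(1)] card_Diff1_le[of "\<Union> (A ` K)" y]
          by (cases "y \<in> \<Union> (A ` K)") simp_all
      qed simp
      have "\<exists>h. inj_on h (I - {i}) \<and> (\<forall>k\<in>I - {i}. h k \<in> B k)"
      proof (rule less.hyps)
        show "card (I - {i}) < card I" using less.prems(1) i by (rule card_Diff1_less)
        show "finite (B k)" if "k \<in> I - {i}" for k
          using that less.prems(2) by (simp add: B_def)
      qed (use less.prems(1) hallB in auto)
      then obtain h where h: "inj_on h (I - {i})" "\<forall>k\<in>I - {i}. h k \<in> B k" by blast
      have "inj_on (h(i := y)) I"
        using h by (auto simp: inj_on_def B_def)
      moreover have "\<forall>k\<in>I. (h(i := y)) k \<in> A k"
        using h(2) y by (auto simp: B_def)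
      ultimately show ?thesis by blast
    qed simp
  qed
qed

text \<open>Hall's theorem in the \<open>p\<close>-regular bipartite multigraph obtained by splitting each \<open>r\<close> into \<open>b r\<close>
  vertices.\<close>

lemma regular_selection:
  fixes w :: "'j \<Rightarrow> 'r \<Rightarrow> nat"
  assumes fin: "finite J" "finite R" and p: "p > 0"
    and rows: "\<And>j. j \<in> J \<Longrightarrow> (\<Sum>r\<in>R. w j r) = p"
    and cols: "\<And>r. r \<in> R \<Longrightarrow> (\<Sum>j\<in>J. w j r) = p * b r"
  obtains h where "\<And>j. j \<in> J \<Longrightarrow> h j \<in> R \<and> w j (h j) > 0"
    and "\<And>r. r \<in> R \<Longrightarrow> card {j \<in> J. h j = r} = b r"
proof -
  \<comment> \<open>The pairs \<open>(r, i)\<close> with \<open>i < b r\<close> are the copies of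
    \<open>r\<close>; an injective choice of copies selects \<open>r\<close> at most
    \<open>b r\<close> times.\<close>
  define A where "A j = (SIGMA r : {r \<in> R. w j r > 0}. {..<b r})" for j
  have "card K \<le> card (\<Union> (A ` K))" if K: "K \<subseteq> J" for K
  proof -
    define N where "N = {r \<in> R. \<exists>j\<in>K. w j r > 0}"
    have finN: "finite N" using fin by (simp add: N_def)
    have "\<Union> (A ` K) = (SIGMA r : N. {..<b r})"
      by (auto simp: A_def N_def)
    then have cardU: "card (\<Union> (A ` K)) = (\<Sum>r\<in>N. b r)"
      using finN by simp
    have "p * card K = (\<Sum>j\<in>K. \<Sum>r\<in>R. w j r)"
      using rows K by (simp add: subset_iff)
    also have "\<dots> = (\<Sum>j\<in>K. \<Sum>r\<in>N. w j r)"
      using fin by (intro sum.cong sum.mono_neutral_right) (auto simp: N_def)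
    also have "\<dots> = (\<Sum>r\<in>N. \<Sum>j\<in>K. w j r)"
      by (rule sum.swap)
    also have "\<dots> \<le> (\<Sum>r\<in>N. \<Sum>j\<in>J. w j r)"
      using fin K by (intro sum_mono sum_mono2) auto
    also have "\<dots> = p * (\<Sum>r\<in>N. b r)"
      using cols by (simp add: N_def sum_distrib_left)
    finally show ?thesis using p cardU by simp
  qed
  moreover have "finite (A j)" for j using fin by (simp add: A_def)
  ultimately obtain g where g: "inj_on g J" "\<forall>j\<in>J. g j \<in> A j"
    using hall[OF fin(1), of A] by blast
  define h where "h = fst \<circ> g"
  have h: "h j \<in> R \<and> w j (h j) > 0" if "j \<in> J" for j
    using g(2) that by (auto simp: A_def h_def)
  have le: "card {j \<in> J. h j = r} \<le> b r" for r
  proof -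
    have "card {j \<in> J. h j = r} \<le> card ({r} \<times> {..<b r})"
    proof (rule card_inj_on_le)
      show "inj_on g {j \<in> J. h j = r}" using g(1) by (rule inj_on_subset) auto
      show "g ` {j \<in> J. h j = r} \<subseteq> {r} \<times> {..<b r}"
        using g(2) by (fastforce simp: A_def h_def)
    qed simp
    then show ?thesis by (simp add: card_cartesian_product)
  qed
  \<comment> \<open>Double counting gives the upper bounds \<open>b r\<close> the total
    \<open>card J\<close>, so all of them are attained.\<close>
  have "p * card J = (\<Sum>j\<in>J. \<Sum>r\<in>R. w j r)" using rows by simp
  also have "\<dots> = (\<Sum>r\<in>R. \<Sum>j\<in>J. w j r)" by (rule sum.swap)
  also have "\<dots> = p * (\<Sum>r\<in>R. b r)" using cols by (simp add: sum_distrib_left)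
  finally have "(\<Sum>r\<in>R. b r) = card J" using p by simp
  also have "\<dots> = (\<Sum>r\<in>R. card {j \<in> J. h j = r})"
    using fin h by (subst card_eq_sum, subst sum.group[symmetric, where T = R and g = h]) auto
  finally have "card {j \<in> J. h j = r} = b r" if "r \<in> R" for r
    using sum_mono_inv[of "\<lambda>r. card {j \<in> J. h j = r}" R b r] le that fin by simp
  with h that show ?thesis by blast
qed

text \<open>Rows with sum below \<open>p\<close> may abstain. Abstaining is the choice of an extra
  column carrying the missing weight; since choices have positive weight, a row with sum
  \<open>p\<close> never abstains.\<close>

lemma balanced_selection:
  fixes w :: "'j \<Rightarrow> 'r \<Rightarrow> nat"
  assumes fin: "finite J" "finite R" and p: "p > 0"
    and rows: "\<And>j. j \<in> J \<Longrightarrow> (\<Sum>r\<in>R. w j r) \<le> p"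
    and cols: "\<And>r. r \<in> R \<Longrightarrow> (\<Sum>j\<in>J. w j r) = p * b r"
  obtains h where "\<And>j r. \<lbrakk>j \<in> J; h j = Some r\<rbrakk> \<Longrightarrow> r \<in> R \<and> w j r > 0"
    and "\<And>r. r \<in> R \<Longrightarrow> card {j \<in> J. h j = Some r} = b r"
    and "\<And>j. \<lbrakk>j \<in> J; h j = None\<rbrakk> \<Longrightarrow> (\<Sum>r\<in>R. w j r) < p"
proof -
  \<comment> \<open>The extra node \<open>None\<close> makes the bipartite multigraph regular on the side of \<open>J\<close>.\<close>
  define w' where "w' j = case_option (p - (\<Sum>r\<in>R. w j r)) (w j)" for j
  define b' where "b' = case_option (card J - (\<Sum>r\<in>R. b r)) b"
  define R' where "R' = insert None (Some ` R)"
  have sumR': "(\<Sum>r\<in>R'. F r) = F None + (\<Sum>r\<in>R. F (Some r))" for F :: "'r option \<Rightarrow> nat"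
    using fin unfolding R'_def by (subst sum.insert) (auto simp: sum.reindex)
  have "(\<Sum>j\<in>J. w' j None) = p * b' None"
  proof -
    have "(\<Sum>j\<in>J. w' j None) = p * card J - (\<Sum>j\<in>J. \<Sum>r\<in>R. w j r)"
      using rows by (simp add: w'_def sum_subtractf_nat mult.commute)
    also have "(\<Sum>j\<in>J. \<Sum>r\<in>R. w j r) = (\<Sum>r\<in>R. \<Sum>j\<in>J. w j r)" by (rule sum.swap)
    also have "\<dots> = p * (\<Sum>r\<in>R. b r)" using cols by (simp add: sum_distrib_left)
    finally show ?thesis by (simp add: b'_def diff_mult_distrib2)
  qed
  then have cols': "(\<Sum>j\<in>J. w' j r) = p * b' r" if "r \<in> R'" for r
    using that cols by (auto simp: R'_def w'_def b'_def)
  have rows': "(\<Sum>r\<in>R'. w' j r) = p" if "j \<in> J" for j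
    using rows[OF that] by (simp add: sumR' w'_def)
  have "finite R'" using fin by (simp add: R'_def)
  from regular_selection[OF fin(1) this p rows' cols'] obtain h where
    h: "\<And>j. j \<in> J \<Longrightarrow> h j \<in> R' \<and> w' j (h j) > 0"
    "\<And>r. r \<in> R' \<Longrightarrow> card {j \<in> J. h j = r} = b' r" by blast
  show ?thesis
  proof (rule that[of h])
    fix j r assume "j \<in> J" "h j = Some r"
    then show "r \<in> R \<and> w j r > 0" using h(1)[of j] by (auto simp: R'_def w'_def)
  next
    fix r assume "r \<in> R"
    then show "card {j \<in> J. h j = Some r} = b r" using h(2)[of "Some r"] by (simp add: R'_def b'_def)
  next
    fix j assume "j \<in> J" "h j = None"
    then show "(\<Sum>r\<in>R. w j r) < p" using h(1)[of j] by (auto simp: w'_def)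
  qed
qed

section \<open>Coloring a complete graph with prescribed missing colors\<close>

text \<open>The vertices in \<open>A\<close> have been split off and those in \<open>V - A\<close> are still amalgamated: \<open>c\<close> colors
  the edges within \<open>A\<close>, \<open>S x\<close> is the set of colors of the edges from \<open>x\<close> to the amalgamated vertex,
  and \<open>l j\<close> is the number of loops of color \<open>j\<close> there.\<close>

definition split_state ::
    "'a set \<Rightarrow> ('a \<Rightarrow> nat) \<Rightarrow> nat \<Rightarrow> 'a set \<Rightarrow> ('a set \<Rightarrow> nat) \<Rightarrow> ('a \<Rightarrow> nat set) \<Rightarrow> (nat \<Rightarrow> nat) \<Rightarrow> bool" where
  "split_state V f n A c S l \<longleftrightarrow>
     (\<forall>x\<in>A. S x \<subseteq> {..<n} \<and> card (S x) = card (V - A) \<and> f x \<notin> S x) \<and>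
     (\<forall>x\<in>A. \<forall>y\<in>A. x \<noteq> y \<longrightarrow> c {x, y} < n \<and> c {x, y} \<noteq> f x \<and> c {x, y} \<notin> S x) \<and>
     (\<forall>x\<in>A. \<forall>y\<in>A. \<forall>z\<in>A. x \<noteq> y \<longrightarrow> x \<noteq> z \<longrightarrow> y \<noteq> z \<longrightarrow> c {x, y} \<noteq> c {x, z}) \<and>
     (\<forall>j<n. card {x \<in> A. j \<in> S x} + 2 * l j + card {x \<in> V - A. f x = j} \<le> card (V - A)) \<and>
     2 * (\<Sum>j<n. l j) = card (V - A) * (card (V - A) - 1)"

text \<open>The colors are the rows of a balanced selection with \<open>p = card (V - A)\<close>.
  The selected edge ends are handed to the new vertex, so each color appears there at most once, and
  each color with \<open>p\<close> ends gives up one.\<close>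

lemma split_state_step:
  assumes V: "finite V" and f: "f \<in> V \<rightarrow> {..<n}" and A: "A \<subset> V"
    and st: "split_state V f n A c S l"
  obtains x c' S' l' where "x \<in> V - A" "split_state V f n (insert x A) c' S' l'"
proof -
  define p where "p = card (V - A)"
  have finA: "finite A" using A V finite_subset by blast
  have p: "p > 0" using A V by (auto simp: p_def card_gt_0_iff)
  have S: "S x \<subseteq> {..<n}" "card (S x) = p" "f x \<notin> S x" if "x \<in> A" for x
    using st that by (auto simp: split_state_def p_def)
  have c: "c {x, y} < n" "c {x, y} \<noteq> f x" "c {x, y} \<notin> S x" if "x \<in> A" "y \<in> A" "x \<noteq> y" for x y
    using st that by (auto simp: split_state_def)
  have c2: "c {x, y} \<noteq> c {x, z}" if "x \<in> A" "y \<in> A" "z \<in> A" "x \<noteq> y" "x \<noteq> z" "y \<noteq> z" for x y z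
    using st that unfolding split_state_def by blast
  have deg: "card {x \<in> A. j \<in> S x} + 2 * l j + card {x \<in> V - A. f x = j} \<le> p" if "j < n" for j
    using st that unfolding split_state_def p_def by blast
  have suml: "2 * (\<Sum>j<n. l j) = p * (p - 1)"
    using st unfolding split_state_def p_def by blast
  \<comment> \<open>\<open>Inl x\<close> stands for the edges to \<open>x\<close>, \<open>Inr True\<close> for the ends of the loops, \<open>Inr False\<close> for the
      prescribed half-edges.\<close>
  define w where "w j = case_sum (\<lambda>x. of_bool (j \<in> S x))
      (\<lambda>loop. if loop then 2 * l j else card {x \<in> V - A. f x = j})" for j
  \<comment> \<open>The column totals are \<open>p\<close> edges to each split vertex,
    \<open>p * (p - 1)\<close> loop ends and \<open>p\<close> half-edges; \<open>b\<close> is the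
    share \<open>1/p\<close> of each.\<close>
  define b :: "'a + bool \<Rightarrow> nat" where "b = case_sum (\<lambda>_. 1) (\<lambda>loop. if loop then p - 1 else 1)"
  define R where "R = A <+> (UNIV :: bool set)"
  have InrR: "Inr loop \<in> R" for loop by (auto simp: R_def)
  have finR: "finite R" using finA by (simp add: R_def)
  have sumR: "(\<Sum>r\<in>R. w j r) = card {x \<in> A. j \<in> S x} + 2 * l j + card {x \<in> V - A. f x = j}" for j
    using finA by (simp add: R_def sum.Plus w_def UNIV_bool Int_def)
  have rows: "(\<Sum>r\<in>R. w j r) \<le> p" if "j \<in> {..<n}" for j
    using deg that by (simp add: sumR)
  have cols: "(\<Sum>j\<in>{..<n}. w j r) = p * b r" if "r \<in> R" for r
  proof (cases r)
    case (Inl x)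
    then have "x \<in> A" using that by (auto simp: R_def)
    then have "{..<n} \<inter> S x = S x" using S(1) by blast
    then show ?thesis using Inl S(2)[OF \<open>x \<in> A\<close>] by (simp add: w_def b_def Int_def)
  next
    case (Inr loop)
    have "(\<Sum>j<n. card {x \<in> V - A. f x = j}) = (\<Sum>j<n. \<Sum>x\<in>{x \<in> V - A. f x = j}. 1)"
      by simp
    also have "\<dots> = (\<Sum>x\<in>V - A. 1)"
      using f V by (intro sum.group) auto
    finally show ?thesis
      using Inr suml by (simp add: w_def b_def p_def sum_distrib_left)
  qed
  obtain h where h: "\<And>j r. \<lbrakk>j \<in> {..<n}; h j = Some r\<rbrakk> \<Longrightarrow> r \<in> R \<and> w j r > 0"
    and hb: "\<And>r. r \<in> R \<Longrightarrow> card {j \<in> {..<n}. h j = Some r} = b r"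
    and hN: "\<And>j. \<lbrakk>j \<in> {..<n}; h j = None\<rbrakk> \<Longrightarrow> (\<Sum>r\<in>R. w j r) < p"
    using balanced_selection[OF finite_lessThan finR p rows cols] by blast
  have "\<exists>j. {j \<in> {..<n}. h j = Some (Inl y)} = {j}" if "y \<in> A" for y
    using hb[of "Inl y"] that by (auto simp: R_def b_def card_1_singleton_iff)
  then obtain q where q: "\<And>y. y \<in> A \<Longrightarrow> {j \<in> {..<n}. h j = Some (Inl y)} = {q y}"
    by metis
  have q1: "q y < n" "h (q y) = Some (Inl y)" "q y \<in> S y" if "y \<in> A" for y
    using q[OF that] h[of "q y" "Inl y"] by (auto simp: w_def split: if_splits)
  have q2: "j = q y" if "j < n" "h j = Some (Inl y)" for j y
  proof -
    have "y \<in> A" using h[of j "Inl y"] that by (auto simp: R_def)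
    then show ?thesis using q[of y] that by blast
  qed
  have "card {j \<in> {..<n}. h j = Some (Inr False)} = 1"
    using hb[OF InrR[of False]] by (simp add: b_def)
  then obtain j0 where j0: "{j \<in> {..<n}. h j = Some (Inr False)} = {j0}"
    by (auto simp: card_1_singleton_iff)
  then have j01: "j0 < n" "h j0 = Some (Inr False)" by auto
  then have "card {x \<in> V - A. f x = j0} > 0"
    using h[of j0 "Inr False"] by (simp add: w_def)
  \<comment> \<open>The selection decides which vertex is split off: the selected half-edge has
    color \<open>j0\<close>, so it belongs to some remaining vertex with that prescribed
    color.\<close>
  then obtain x where x: "x \<in> V" "x \<notin> A" "f x = j0"
    by (auto simp: card_gt_0_iff)
  define L where "L = {j \<in> {..<n}. h j = Some (Inr True)}"
  have L: "card L = p - 1" "L \<subseteq> {..<n}" "finite L"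
    using hb[OF InrR[of True]] by (auto simp: b_def L_def)
  have lpos: "l j > 0" if "j \<in> L" for j
    using h[of j "Inr True"] that by (simp add: L_def w_def)
  have j0L: "j0 \<notin> L" using j01 by (simp add: L_def)
  \<comment> \<open>The edge from \<open>x\<close> to \<open>y\<close> in \<open>A\<close> inherits
    the color \<open>q y\<close> selected at \<open>y\<close>; \<open>the_elem\<close> recovers
    \<open>y\<close> from the pair.\<close>
  define c' where "c' e = (if x \<in> e then q (the_elem (e - {x})) else c e)" for e
  \<comment> \<open>Each selected loop becomes an edge from \<open>x\<close> to the amalgamated
    vertex, hence \<open>L\<close> is the color set of \<open>x\<close>. By \<open>lpos\<close>, the
    subtraction in \<open>l'\<close> is not cut off at zero.\<close>
  define S' where "S' y = (if y = x then L else S y - {q y})" for y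
  define l' where "l' j = l j - of_bool (j \<in> L)" for j
  have c'x: "c' {x, y} = q y" "c' {y, x} = q y" if "y \<in> A" for y
  proof -
    have "{x, y} - {x} = {y}" using that x by auto
    then show "c' {x, y} = q y" by (simp add: c'_def)
    then show "c' {y, x} = q y" by (simp add: insert_commute)
  qed
  have c'A: "c' {y, z} = c {y, z}" if "y \<in> A" "z \<in> A" for y z
    using that x by (auto simp: c'_def)
  have S'x: "S' x = L" by (simp add: S'_def)
  have S'A: "S' y = S y - {q y}" if "y \<in> A" for y
    using that x by (auto simp: S'_def)
  have qinj: "q y \<noteq> q z" if "y \<in> A" "z \<in> A" "y \<noteq> z" for y z
    using q1(2)[of y] q1(2)[of z] that by auto
  have VA: "V - insert x A = (V - A) - {x}" by auto
  have p': "card (V - insert x A) = p - 1"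
    using x V by (simp add: VA p_def)
  have "split_state V f n (insert x A) c' S' l'"
    unfolding split_state_def p'
  proof (intro conjI ballI allI impI)
    fix y assume y: "y \<in> insert x A"
    have "S' y \<subseteq> {..<n} \<and> card (S' y) = p - 1 \<and> f y \<notin> S' y"
    proof (cases "y = x")
      case True
      then show ?thesis using L x j0L by (simp add: S'x)
    next
      case False
      then have "y \<in> A" using y by simp
      then show ?thesis using S[of y] q1(3)[of y] by (auto simp: S'A)
    qed
    then show "S' y \<subseteq> {..<n}" "card (S' y) = p - 1" "f y \<notin> S' y" by auto
  next
    fix y z assume "y \<in> insert x A" "z \<in> insert x A" "y \<noteq> z"
    then consider "y = x" "z \<in> A" | "y \<in> A" "z = x" | "y \<in> A" "z \<in> A" by auto
    then have "c' {y, z} < n \<and> c' {y, z} \<noteq> f y \<and> c' {y, z} \<notin> S' y"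
    proof cases
      case 1
      then show ?thesis using q1[of z] j01 x by (auto simp: c'x S'x L_def)
    next
      case 2
      then show ?thesis using q1[of y] S(3)[of y] by (auto simp: c'x S'A)
    next
      case 3
      then show ?thesis using c[of y z] \<open>y \<noteq> z\<close> by (simp add: c'A S'A)
    qed
    then show "c' {y, z} < n" "c' {y, z} \<noteq> f y" "c' {y, z} \<notin> S' y" by auto
  next
    fix u y z assume *: "u \<in> insert x A" "y \<in> insert x A" "z \<in> insert x A" "u \<noteq> y" "u \<noteq> z" "y \<noteq> z"
    consider "u = x" | "y = x" | "z = x" | "u \<noteq> x" "y \<noteq> x" "z \<noteq> x" by blast
    then show "c' {u, y} \<noteq> c' {u, z}"
    proof cases
      case 1
      with * have "y \<in> A" "z \<in> A" by auto
      then show ?thesis using qinj[of y z] * 1 by (simp add: c'x)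
    next
      case 2
      with * have "u \<in> A" "z \<in> A" by auto
      then show ?thesis using c(3)[of u z] q1(3)[of u] * 2 by (auto simp: c'x c'A)
    next
      case 3
      with * have "u \<in> A" "y \<in> A" by auto
      then show ?thesis using c(3)[of u y] q1(3)[of u] * 3 by (auto simp: c'x c'A)
    next
      case 4
      with * have "u \<in> A" "y \<in> A" "z \<in> A" by auto
      then show ?thesis using c2[of u y z] * by (simp add: c'A)
    qed
  next
    fix j assume j: "j < n"
    let ?s = "\<lambda>A S. card {y \<in> A. j \<in> S y}" and ?t = "\<lambda>A. card {y \<in> V - A. f y = j}"
    have s: "?s (insert x A) S' = ?s A S' + of_bool (j \<in> L)"
    proof (cases "j \<in> L")
      case True
      then have "{y \<in> insert x A. j \<in> S' y} = insert x {y \<in> A. j \<in> S' y}" by (auto simp: S'x)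
      then show ?thesis using x finA True by simp
    next
      case False
      then have "{y \<in> insert x A. j \<in> S' y} = {y \<in> A. j \<in> S' y}" by (auto simp: S'x)
      then show ?thesis using False by simp
    qed
    have sle: "?s A S' \<le> ?s A S"
      using finA by (intro card_mono) (auto simp: S'A)
    have tle: "?t (insert x A) \<le> ?t A"
      using V by (intro card_mono) auto
    consider "h j = None" | y where "h j = Some (Inl y)" | "h j = Some (Inr True)"
      | "h j = Some (Inr False)"
    proof (cases "h j")
      case (Some r)
      show ?thesis
      proof (cases r)
        case (Inl y)
        with Some that(2) show ?thesis by simp
      next
        case (Inr loop)
        with Some that(3,4) show ?thesis by (cases loop) simp_all
      qed
    qed (use that in blast)
    \<comment> \<open>An unselected color had fewer than \<open>p\<close> ends already. Any other
      color loses one end: an edge to \<open>y\<close>, a half-edge, or a loop traded for one edge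
      from \<open>x\<close>.\<close>
    then show "?s (insert x A) S' + 2 * l' j + ?t (insert x A) \<le> p - 1"
    proof cases
      case 1
      then have "j \<notin> L" by (simp add: L_def)
      then show ?thesis using hN[of j] 1 j s sle tle by (simp add: sumR l'_def)
    next
      case (2 y)
      then have "j \<notin> L" by (simp add: L_def)
      have jy: "j = q y" "y \<in> A" using q2 2 j h[of j "Inl y"] by (auto simp: R_def)
      have "y \<in> {y \<in> A. j \<in> S y}" "y \<notin> {y \<in> A. j \<in> S' y}"
        using jy q1[of y] by (auto simp: S'A)
      moreover have "{y \<in> A. j \<in> S' y} \<subseteq> {y \<in> A. j \<in> S y}" by (auto simp: S'A)
      ultimately have "?s A S' < ?s A S"
        using finA by (intro psubset_card_mono) auto
      then show ?thesis using deg[OF j] s tle \<open>j \<notin> L\<close> by (simp add: l'_def)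
    next
      case 3
      then have "j \<in> L" using j by (simp add: L_def)
      then show ?thesis using deg[OF j] s sle tle lpos[of j] by (simp add: l'_def)
    next
      case 4
      then have "j = j0" "j \<notin> L" using j0 j by (auto simp: L_def)
      have "?t (insert x A) < ?t A"
        using V x \<open>j = j0\<close> by (intro psubset_card_mono) auto
      then show ?thesis using deg[OF j] s sle \<open>j \<notin> L\<close> by (simp add: l'_def)
    qed
  next
    have "(\<Sum>j<n. l j) = (\<Sum>j<n. l' j + of_bool (j \<in> L))"
      using lpos by (intro sum.cong) (auto simp: l'_def Suc_leI)
    also have "\<dots> = (\<Sum>j<n. l' j) + (p - 1)"
      using L by (simp add: sum.distrib Int_absorb1)
    finally have "2 * (\<Sum>j<n. l' j) + 2 * (p - 1) = p * (p - 1)" using suml by simp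
    moreover have "p * (p - 1) = (p - 1) * (p - 1 - 1) + 2 * (p - 1)"
    proof (cases "p = 1")
      case False
      then have "p = (p - 2) + 2" using p by simp
      then obtain k where "p = k + 2" by blast
      then show ?thesis by simp
    qed simp
    ultimately show "2 * (\<Sum>j<n. l' j) = (p - 1) * (p - 1 - 1)" by simp
  qed
  then show ?thesis using that[of x] x by blast
qed

text \<open>The splitting step is iterated from \<open>A = {}\<close> to \<open>A = V\<close>, where
  \<open>c\<close> colors the whole complete graph.\<close>

lemma complete_graph_coloring_of_loops:
  fixes l :: "nat \<Rightarrow> nat"
  assumes V: "finite V" and f: "f \<in> V \<rightarrow> {..<n}"
    and deg: "\<And>j. j < n \<Longrightarrow> 2 * l j + card {x \<in> V. f x = j} \<le> card V"
    and suml: "2 * (\<Sum>j<n. l j) = card V * (card V - 1)"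
  obtains c where
    "\<And>x y. \<lbrakk>x \<in> V; y \<in> V; x \<noteq> y\<rbrakk> \<Longrightarrow> c {x, y} < n \<and> c {x, y} \<noteq> f x"
    "\<And>x y z. \<lbrakk>x \<in> V; y \<in> V; z \<in> V; x \<noteq> y; x \<noteq> z; y \<noteq> z\<rbrakk> \<Longrightarrow> c {x, y} \<noteq> c {x, z}"
proof -
  have "\<exists>A c S l. A \<subseteq> V \<and> card A = k \<and> split_state V f n A c S l" if "k \<le> card V" for k
    using that
  proof (induction k)
    case 0
    \<comment> \<open>Nothing is split off yet, so only the loop counts are constrained and
      \<open>c\<close>, \<open>S\<close> are arbitrary.\<close>
    have "split_state V f n {} c S l" for c S
      using deg suml by (simp add: split_state_def)
    then show ?case by (metis card.empty empty_subsetI)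
  next
    case (Suc k)
    then obtain A c S l where A: "A \<subseteq> V" "card A = k" "split_state V f n A c S l" by auto
    then have "A \<subset> V" using Suc.prems by auto
    from split_state_step[OF V f this A(3)] obtain x c' S' l'
      where x: "x \<in> V - A" "split_state V f n (insert x A) c' S' l'" by blast
    moreover have "card (insert x A) = Suc k"
      using x A finite_subset[OF A(1) V] by simp
    ultimately show ?case using A(1) by (metis Diff_iff insert_subset)
  qed
  from this[of "card V"] obtain A c S l where A: "A \<subseteq> V" "card A = card V" "split_state V f n A c S l"
    by auto
  then have "A = V" using V card_subset_eq by blast
  with A(3) have "split_state V f n V c S l" by simp
  then show ?thesis
    by (intro that[of c]) (simp_all add: split_state_def)
qed

section \<open>Choosing the number of loops of each color\<close>

text \<open>This trims the maximal loop numbers of the colors to the exact total required.\<close>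

lemma sum_eq_below:
  fixes h :: "'j \<Rightarrow> nat"
  assumes "finite J" "N \<le> sum h J"
  obtains g where "\<And>j. j \<in> J \<Longrightarrow> g j \<le> h j" "sum g J = N"
proof -
  have "\<exists>g. (\<forall>j\<in>J. g j \<le> h j) \<and> sum g J = N"
    using assms
  proof (induction J arbitrary: N rule: finite_induct)
    case (insert a J)
    define k where "k = min N (h a)"
    have "N - k \<le> sum h J" using insert.prems insert.hyps by (simp add: k_def)
    then obtain g where g: "\<forall>j\<in>J. g j \<le> h j" "sum g J = N - k" using insert.IH by blast
    have "sum (g(a := k)) J = sum g J" using insert.hyps by (intro sum.cong) auto
    then have "sum (g(a := k)) (insert a J) = N"
      using insert.hyps g(2) by (simp add: k_def)
    moreover have "\<forall>j\<in>insert a J. (g(a := k)) j \<le> h j" using g(1) by (simp add: k_def)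
    ultimately show ?case by blast
  qed simp
  then show ?thesis using that by blast
qed

text \<open>After its \<open>m j\<close> half-edges, color \<open>j\<close> has room for
  \<open>h j\<close> loops, with one end wasted exactly when \<open>j\<close> is in
  \<open>D\<close>. It remains to see that the \<open>h j\<close> sum to at least
  \<open>d * (d - 1) div 2\<close>.\<close>

lemma complete_graph_coloring:
  assumes V: "finite V" and f: "f \<in> V \<rightarrow> {..<n}"
    and cases: "card V < n \<or> card V = n \<and> odd n \<and> inj_on f V \<or> card V = n \<and> even n \<and> f ` V \<subseteq> {a}"
  obtains c :: "'a set \<Rightarrow> nat" where
    "\<And>x y. \<lbrakk>x \<in> V; y \<in> V; x \<noteq> y\<rbrakk> \<Longrightarrow> c {x, y} < n \<and> c {x, y} \<noteq> f x"
    "\<And>x y z. \<lbrakk>x \<in> V; y \<in> V; z \<in> V; x \<noteq> y; x \<noteq> z; y \<noteq> z\<rbrakk> \<Longrightarrow> c {x, y} \<noteq> c {x, z}"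
proof -
  define d where "d = card V"
  define m where "m j = card {x \<in> V. f x = j}" for j
  define h where "h j = (d - m j) div 2" for j
  define D where "D = {j \<in> {..<n}. odd (d - m j)}"
  have m_le: "m j \<le> d" for j
    using V by (auto simp: m_def d_def intro: card_mono)
  have summ: "(\<Sum>j<n. m j) = d"
  proof -
    have "(\<Sum>j<n. m j) = (\<Sum>j<n. \<Sum>x\<in>{x \<in> V. f x = j}. 1)" by (simp add: m_def)
    also have "\<dots> = (\<Sum>x\<in>V. 1)" using f V by (intro sum.group) auto
    finally show ?thesis by (simp add: d_def)
  qed
  have "n * d = (\<Sum>j<n. m j + (d - m j))" using m_le by simp
  also have "\<dots> = (\<Sum>j<n. m j + (2 * h j + of_bool (odd (d - m j))))"
    unfolding h_def by (intro sum.cong refl arg_cong2[of _ _ _ _ "(+)"]) (simp only: of_bool_odd_eq_mod_2 mult_div_mod_eq)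
  also have "\<dots> = d + 2 * sum h {..<n} + card D"
    by (simp add: sum.distrib summ D_def sum_distrib_left Int_def)
  finally have nd: "n * d = d + 2 * sum h {..<n} + card D" .
  have O_le: "card D \<le> n"
    using card_mono[of "{..<n}" D] by (auto simp: D_def)
  \<comment> \<open>By \<open>nd\<close>, this is the required bound on the sum of \<open>h\<close>:
    the number of wasted ends must be at most \<open>d * (n - d)\<close>.\<close>
  have "d * d + card D \<le> n * d"
    using cases
  proof (elim disjE conjE)
    assume "card V < n"
    then have "d < n" by (simp add: d_def)
    \<comment> \<open>In the last case \<open>d * (n - d)\<close> is at least \<open>n\<close>, so
      \<open>card D \<le> n\<close> suffices. For \<open>d = 1\<close> and for
      \<open>n = d + 1\<close> the bound needed is \<open>n - 1\<close>, and \<open>nd\<close> rules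
      out \<open>card D = n\<close>.\<close>
    consider "d = 0" | "d = 1" | "n = d + 1" | "d \<ge> 2" "n \<ge> d + 2" using \<open>d < n\<close> by linarith
    then show ?thesis
    proof cases
      case 1
      then have "D = {}" by (auto simp: D_def)
      then show ?thesis using 1 by simp
    next
      case 2
      then have "card D \<noteq> n" using nd by auto
      then show ?thesis using 2 O_le by simp
    next
      case 3
      have "even (n * d)" using 3 by auto
      then have "even (d + card D)" unfolding nd by simp
      then have "card D \<noteq> n" using 3 by auto
      then show ?thesis using 3 O_le by simp
    next
      case 4
      then obtain s t where "d = 2 + s" "n = d + 2 + t" by (metis le_iff_add)
      then show ?thesis using O_le by (simp add: algebra_simps)
    qed
  next
    assume *: "card V = n" "odd n" "inj_on f V"
    then have "f ` V = {..<n}"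
      using f V by (intro card_subset_eq) (auto simp: card_image)
    have "m j = 1" if "j < n" for j
    proof -
      have "j \<in> f ` V" using that \<open>f ` V = {..<n}\<close> by simp
      then obtain x where "x \<in> V" "f x = j" by blast
      then have "{x \<in> V. f x = j} = {x}" using *(3) by (auto simp: inj_on_def)
      then show ?thesis by (simp add: m_def)
    qed
    then have "D = {}" using * by (auto simp: D_def d_def)
    then show ?thesis using * by (simp add: d_def)
  next
    assume *: "card V = n" "even n" "f ` V \<subseteq> {a}"
    have "even (m j)" for j
    proof -
      have "{x \<in> V. f x = j} = V \<or> {x \<in> V. f x = j} = {}" using *(3) by blast
      then show ?thesis using * unfolding m_def by (metis card.empty even_zero)
    qed
    then have "D = {}" using * m_le by (auto simp: D_def d_def)
    then show ?thesis using * by (simp add: d_def)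
  qed
  then have "d * d \<le> d + 2 * sum h {..<n}" using nd by simp
  then have "d * (d - 1) \<le> 2 * sum h {..<n}" by (simp add: diff_mult_distrib2)
  then have half: "d * (d - 1) div 2 \<le> sum h {..<n}" by simp
  have even: "even (d * (d - 1))" by (cases "even d") simp_all
  obtain l where l: "\<And>j. j \<in> {..<n} \<Longrightarrow> l j \<le> h j" "sum l {..<n} = d * (d - 1) div 2"
    using sum_eq_below[OF finite_lessThan half] by blast
  have "2 * l j + card {x \<in> V. f x = j} \<le> card V" if "j < n" for j
    using l(1)[of j] that m_le[of j] by (auto simp: h_def m_def d_def)
  moreover have "2 * (\<Sum>j<n. l j) = card V * (card V - 1)"
    using l(2) even by (simp add: d_def)
  ultimately show ?thesis
    using complete_graph_coloring_of_loops[OF V f, of l] that by blast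
qed

section \<open>Edge colorings of the complete truncation\<close>

context multigraph
begin

lemma finite_incident_edges: "finite (incident_edges X v)"
  using finite_edges by (simp add: incident_edges_def)

lemma valency_le_max_valency: "v \<in> verts X \<Longrightarrow> valency X v \<le> max_valency X"
  using finite_verts by (simp add: max_valency_def)

lemma valency_le_of_proper_edge_coloring:
  assumes "proper_edge_coloring X k c" "v \<in> verts X"
  shows "valency X v \<le> k"
proof -
  have "inj_on c (incident_edges X v)" "c ` incident_edges X v \<subseteq> {..<k}"
    using assms by (auto simp: proper_edge_coloring_def edge_coloring_def incident_edges_def)
  then show ?thesis
    unfolding valency_def by (metis card_inj_on_le card_lessThan finite_lessThan)
qed

lemma max_valency_le_of_proper_edge_coloring:
  "proper_edge_coloring X k c \<Longrightarrow> max_valency X \<le> k"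
  using valency_le_of_proper_edge_coloring finite_verts by (auto simp: max_valency_def)

lemma class_I_iff: "class_I X \<longleftrightarrow> (\<exists>c. proper_edge_coloring X (max_valency X) c)"
proof
  \<comment> \<open>Giving all edges different colors shows that the \<open>LEAST\<close> in
    \<open>chromatic_index\<close> is attained.\<close>
  obtain c where "bij_betw c (edges X) {0..<card (edges X)}"
    using ex_bij_betw_finite_nat[OF finite_edges] by blast
  then have "proper_edge_coloring X (card (edges X)) c"
    unfolding proper_edge_coloring_def edge_coloring_def bij_betw_def incident_edges_def
    by (auto intro: inj_on_subset)
  then have ex: "\<exists>k c. proper_edge_coloring X k c" by blast
  assume "class_I X"
  then show "\<exists>c. proper_edge_coloring X (max_valency X) c"
    using LeastI_ex[OF ex] by (simp add: class_I_def chromatic_index_def)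
next
  assume "\<exists>c. proper_edge_coloring X (max_valency X) c"
  then show "class_I X"
    unfolding class_I_def chromatic_index_def
    by (intro Least_equality) (auto intro: max_valency_le_of_proper_edge_coloring)
qed

section \<open>Incidence and valencies in the complete truncation\<close>

lemma verts_complete_truncation:
  "verts (complete_truncation X) = (SIGMA v : verts X. incident_edges X v)"
  by (auto simp: complete_truncation_def gen_truncation_def cluster_def)

lemma edges_complete_truncation:
  "edges (complete_truncation X) =
     matching_edge X ` edges X \<union> (\<Union>v\<in>verts X. complete_graph_edges (cluster X v))"
  by (simp add: complete_truncation_def gen_truncation_def)

lemma ends_complete_truncation: "ends (complete_truncation X) S = S"
  by (simp add: complete_truncation_def gen_truncation_def)

lemma incident_edges_complete_truncation:
  assumes "v \<in> verts X" "e \<in> incident_edges X v"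
  shows "incident_edges (complete_truncation X) (v, e) =
    insert (matching_edge X e) ((\<lambda>e'. {(v, e), (v, e')}) ` (incident_edges X v - {e}))" (is "?L = ?R")
proof
  show "?L \<subseteq> ?R"
  proof
    fix S assume "S \<in> ?L"
    then have S: "S \<in> edges (complete_truncation X)" "(v, e) \<in> S"
      by (auto simp: incident_edges_def ends_complete_truncation)
    then consider e' where "S = matching_edge X e'" | u where "S \<in> complete_graph_edges (cluster X u)"
      unfolding edges_complete_truncation by blast
    then show "S \<in> ?R"
    proof cases
      case 1
      then show ?thesis using S(2) by (auto simp: matching_edge_def)
    next
      case 2
      then have sub: "S \<subseteq> {v} \<times> incident_edges X v" and card: "card S = 2"
        using S(2) by (auto simp: complete_graph_edges_def cluster_def)
      obtain y where y: "S = {(v, e), y}" "y \<noteq> (v, e)"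
        using card S(2) by (metis card_2_iff doubleton_eq_iff insertE singletonD)
      then obtain e' where "y = (v, e')" "e' \<in> incident_edges X v - {e}"
        using sub by auto
      then show ?thesis using y by blast
    qed
  qed
  show "?R \<subseteq> ?L"
  proof
    fix S assume "S \<in> ?R"
    then consider "S = matching_edge X e"
      | e' where "S = {(v, e), (v, e')}" "e' \<in> incident_edges X v" "e' \<noteq> e" by auto
    then show "S \<in> ?L"
    proof cases
      case 1
      then show ?thesis using assms(2)
        by (auto simp: incident_edges_def ends_complete_truncation edges_complete_truncation matching_edge_def)
    next
      case 2
      then have "S \<in> complete_graph_edges (cluster X v)"
        using assms(2) by (auto simp: complete_graph_edges_def cluster_def)
      then show ?thesis using 2 assms(1)
        by (auto simp: incident_edges_def ends_complete_truncation edges_complete_truncation)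
    qed
  qed
qed

lemma matching_edge_neq_constituent_edge:
  assumes "e \<in> edges X"
  shows "matching_edge X e \<noteq> {(v, e), (v, e')}"
proof
  obtain x y where "ends X e = {x, y}" "x \<noteq> y"
    using card_ends[OF assms] by (auto simp: card_2_iff)
  moreover assume "matching_edge X e = {(v, e), (v, e')}"
  then have "fst ` matching_edge X e = {v}" by simp
  ultimately show False by (auto simp: matching_edge_def)
qed

lemma valency_complete_truncation:
  assumes "v \<in> verts X" "e \<in> incident_edges X v"
  shows "valency (complete_truncation X) (v, e) = valency X v"
proof -
  have e: "e \<in> edges X" using assms(2) by (simp add: incident_edges_def)
  have "inj_on (\<lambda>e'. {(v, e), (v, e')}) (incident_edges X v - {e})"
    by (auto simp: inj_on_def doubleton_eq_iff)
  moreover have "matching_edge X e \<notin> (\<lambda>e'. {(v, e), (v, e')}) ` (incident_edges X v - {e})"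
    using matching_edge_neq_constituent_edge[OF e] by blast
  ultimately show ?thesis
    unfolding valency_def incident_edges_complete_truncation[OF assms]
    using finite_incident_edges[of v] assms(2)
    by (simp add: card_image card_Suc_Diff1 del: card_Diff_insert)
qed

text \<open>Every cluster is nonempty, so each valency of \<open>X\<close> recurs at the vertices of
  its cluster and no other valencies arise.\<close>

lemma max_valency_complete_truncation:
  assumes "no_isolated_vertices X"
  shows "max_valency (complete_truncation X) = max_valency X"
proof -
  have "incident_edges X v \<noteq> {}" if "v \<in> verts X" for v
    using assms that by (auto simp: no_isolated_vertices_def valency_def)
  then have "fst ` verts (complete_truncation X) = verts X"
    by (force simp: verts_complete_truncation)
  moreover have "valency (complete_truncation X) ` verts (complete_truncation X) =
      (\<lambda>p. valency X (fst p)) ` verts (complete_truncation X)"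
    by (intro image_cong refl) (auto simp: verts_complete_truncation valency_complete_truncation)
  ultimately show ?thesis
    by (simp add: max_valency_def image_image[of "valency X" fst, symmetric])
qed

section \<open>Transfer of colorings between \<open>X\<close> and its complete truncation\<close>

text \<open>Parity shows that no color is missing on the \<open>k\<close> matching edges at
  \<open>v\<close>; a map from a \<open>k\<close>-set onto \<open>k\<close> colors is
  injective.\<close>

lemma inj_on_matching_coloring:
  assumes C: "proper_edge_coloring (complete_truncation X) k C"
    and v: "v \<in> verts X" "valency X v = k" and "odd k"
  shows "inj_on (\<lambda>e. C (matching_edge X e)) (incident_edges X v)"
proof (rule eq_card_imp_inj_on)
  let ?I = "incident_edges X v" and ?T = "complete_truncation X"
  show "finite ?I" by (rule finite_incident_edges)
  have "(v, e) \<in> verts ?T" if "e \<in> ?I" for e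
    using v(1) that by (simp add: verts_complete_truncation)
  then have inj: "inj_on C (incident_edges ?T (v, e))" if "e \<in> ?I" for e
    using C that unfolding proper_edge_coloring_def by blast
  have range: "C S < k" if "S \<in> edges ?T" for S
    using C that by (auto simp: proper_edge_coloring_def edge_coloring_def)
  have "(\<lambda>e. C (matching_edge X e)) ` ?I = {..<k}"
  proof
    show "(\<lambda>e. C (matching_edge X e)) ` ?I \<subseteq> {..<k}"
      using range by (auto simp: edges_complete_truncation incident_edges_def)
    show "{..<k} \<subseteq> (\<lambda>e. C (matching_edge X e)) ` ?I"
    proof (rule ccontr)
      assume "\<not> ?thesis"
      then obtain j where j: "j < k" "\<And>e. e \<in> ?I \<Longrightarrow> C (matching_edge X e) \<noteq> j" by auto
      define M where "M = {S \<in> complete_graph_edges (cluster X v). C S = j}"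
      have "\<exists>S\<in>M. (v, e) \<in> S" if e: "e \<in> ?I" for e
      proof -
        \<comment> \<open>The vertex has valency \<open>k\<close>, so all \<open>k\<close> colors
          occur at it; \<open>j\<close>, absent from the matching edge, must occur on a constituent
          edge.\<close>
        have "C ` incident_edges ?T (v, e) = {..<k}"
        proof (rule card_subset_eq)
          show "C ` incident_edges ?T (v, e) \<subseteq> {..<k}"
            using range by (auto simp: incident_edges_def)
          show "card (C ` incident_edges ?T (v, e)) = card {..<k}"
            using inj[OF e] valency_complete_truncation[OF v(1) e] v(2)
            by (simp add: card_image valency_def)
        qed simp
        then have "j \<in> C ` incident_edges ?T (v, e)" using j(1) by simp
        then obtain S where "S \<in> incident_edges ?T (v, e)" "C S = j" by blast
        then obtain e' where "S = {(v, e), (v, e')}" "e' \<in> ?I" "e' \<noteq> e" "C S = j"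
          using j(2)[OF e] unfolding incident_edges_complete_truncation[OF v(1) e] by auto
        then have "S \<in> M" "(v, e) \<in> S"
          using e by (auto simp: M_def complete_graph_edges_def cluster_def)
        then show ?thesis by blast
      qed
      then have U: "\<Union> M = cluster X v"
        by (fastforce simp: M_def complete_graph_edges_def cluster_def)
      have "2 * card M = card (\<Union> M)"
      proof (rule card_partition)
        have "M \<subseteq> Pow (cluster X v)" by (auto simp: M_def complete_graph_edges_def)
        then show "finite M" using finite_cluster finite_subset by blast
        show "finite (\<Union> M)" unfolding U by (rule finite_cluster)
        show "card S = 2" if "S \<in> M" for S
          using that by (simp add: M_def complete_graph_edges_def)
        fix S S' assume SS: "S \<in> M" "S' \<in> M" "S \<noteq> S'"
        show "S \<inter> S' = {}"
        proof (rule ccontr)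
          assume "S \<inter> S' \<noteq> {}"
          then obtain e where e: "(v, e) \<in> S" "(v, e) \<in> S'" "e \<in> ?I"
            using SS by (auto simp: M_def complete_graph_edges_def cluster_def)
          then have "S \<in> incident_edges ?T (v, e)" "S' \<in> incident_edges ?T (v, e)"
            using SS v(1)
            by (auto simp: M_def incident_edges_def edges_complete_truncation ends_complete_truncation)
          then show False using inj[OF e(3)] SS by (auto simp: M_def inj_on_def)
        qed
      qed
      then show False using U v(2) \<open>odd k\<close> card_cluster[of v] by (metis dvd_triv_left)
    qed
  qed
  then show "card ((\<lambda>e. C (matching_edge X e)) ` ?I) = card ?I"
    using v(2) by (simp add: valency_def)
qed

text \<open>The colors \<open>c\<close> go on the matching edges. The constituents are
  vertex-disjoint, so each can be colored separately, avoiding \<open>c e\<close> at the vertex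
  \<open>(v, e)\<close>.\<close>

lemma proper_edge_coloring_complete_truncation:
  assumes c: "c \<in> edges X \<rightarrow> {..<n}"
    and cases: "\<And>v. v \<in> verts X \<Longrightarrow> valency X v < n \<or>
      valency X v = n \<and> odd n \<and> inj_on c (incident_edges X v) \<or>
      valency X v = n \<and> even n \<and> c ` incident_edges X v \<subseteq> {a}"
  shows "\<exists>C. proper_edge_coloring (complete_truncation X) n C"
proof -
  let ?I = "incident_edges X" and ?T = "complete_truncation X"
  have I: "e \<in> edges X" if "e \<in> ?I v" for e v using that by (simp add: incident_edges_def)
  define good :: "'v \<Rightarrow> ('e set \<Rightarrow> nat) \<Rightarrow> bool" where "good v col \<longleftrightarrow>
      (\<forall>x\<in>?I v. \<forall>y\<in>?I v. x \<noteq> y \<longrightarrow> col {x, y} < n \<and> col {x, y} \<noteq> c x) \<and>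
      (\<forall>x\<in>?I v. \<forall>y\<in>?I v. \<forall>z\<in>?I v. x \<noteq> y \<longrightarrow> x \<noteq> z \<longrightarrow> y \<noteq> z \<longrightarrow> col {x, y} \<noteq> col {x, z})" for v col
  have "\<exists>col. good v col" if "v \<in> verts X" for v
  proof (rule complete_graph_coloring[OF finite_incident_edges _ cases[OF that, unfolded valency_def]])
    show "c \<in> ?I v \<rightarrow> {..<n}" using c I by auto
  next
    fix col :: "'e set \<Rightarrow> nat"
    assume "\<And>x y. \<lbrakk>x \<in> ?I v; y \<in> ?I v; x \<noteq> y\<rbrakk> \<Longrightarrow> col {x, y} < n \<and> col {x, y} \<noteq> c x"
      "\<And>x y z. \<lbrakk>x \<in> ?I v; y \<in> ?I v; z \<in> ?I v; x \<noteq> y; x \<noteq> z; y \<noteq> z\<rbrakk> \<Longrightarrow> col {x, y} \<noteq> col {x, z}"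
    then have "good v col" by (simp add: good_def)
    then show "\<exists>col. good v col" by blast
  qed
  then obtain col where good: "\<And>v. v \<in> verts X \<Longrightarrow> good v (col v)" by metis
  have col: "col v {x, y} < n" "col v {x, y} \<noteq> c x"
    if "v \<in> verts X" "x \<in> ?I v" "y \<in> ?I v" "x \<noteq> y" for v x y
    using good that unfolding good_def by blast+
  have col2: "col v {x, y} \<noteq> col v {x, z}"
    if "v \<in> verts X" "x \<in> ?I v" "y \<in> ?I v" "z \<in> ?I v" "x \<noteq> y" "x \<noteq> z" "y \<noteq> z" for v x y z
    using good that unfolding good_def by blast
  \<comment> \<open>Both ends of a matching edge carry the same edge of \<open>X\<close>, whereas a
    constituent edge joins ends with one label and two different edges; \<open>snd\<close> thus
    tells them apart.\<close>
  define C where "C S = (if is_singleton (snd ` S) then c (the_elem (snd ` S))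
      else col (the_elem (fst ` S)) (snd ` S))" for S
  have C1: "C (matching_edge X e) = c e" if "e \<in> edges X" for e
  proof -
    have "ends X e \<noteq> {}" using card_ends[OF that] by auto
    then have "snd ` matching_edge X e = {e}" by (force simp: matching_edge_def)
    then show ?thesis by (simp add: C_def)
  qed
  have C2: "C {(v, x), (v, y)} = col v {x, y}" if "x \<noteq> y" for v x y
    using that by (auto simp: C_def is_singleton_def)
  have "proper_edge_coloring ?T n C"
    unfolding proper_edge_coloring_def edge_coloring_def
  proof (intro conjI ballI funcsetI)
    fix S assume "S \<in> edges ?T"
    then consider e where "e \<in> edges X" "S = matching_edge X e"
      | v where "v \<in> verts X" "S \<in> complete_graph_edges (cluster X v)"
      unfolding edges_complete_truncation by blast
    then show "C S \<in> {..<n}"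
    proof cases
      case 1
      then show ?thesis using c C1 by auto
    next
      case 2
      then obtain x y where "S = {(v, x), (v, y)}" "x \<in> ?I v" "y \<in> ?I v" "x \<noteq> y"
        by (auto simp: complete_graph_edges_def cluster_def card_2_iff)
      then show ?thesis using col 2 C2 by auto
    qed
  next
    fix p assume "p \<in> verts ?T"
    then obtain v e where p: "p = (v, e)" "v \<in> verts X" "e \<in> ?I v"
      by (auto simp: verts_complete_truncation)
    have "inj_on C ((\<lambda>e'. {(v, e), (v, e')}) ` (?I v - {e}))"
    proof (rule inj_onI)
      fix S S' assume "S \<in> (\<lambda>e'. {(v, e), (v, e')}) ` (?I v - {e})"
        "S' \<in> (\<lambda>e'. {(v, e), (v, e')}) ` (?I v - {e})" and eq: "C S = C S'"
      then obtain x y where xy: "S = {(v, e), (v, x)}" "x \<in> ?I v" "x \<noteq> e"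
        "S' = {(v, e), (v, y)}" "y \<in> ?I v" "y \<noteq> e" by auto
      then have "col v {e, x} = col v {e, y}" using eq C2[of e x v] C2[of e y v] by auto
      then have "x = y" using col2[of v e x y] p xy by blast
      then show "S = S'" using xy by simp
    qed
    moreover have "C (matching_edge X e) \<notin> C ` ((\<lambda>e'. {(v, e), (v, e')}) ` (?I v - {e}))"
    proof
      assume "C (matching_edge X e) \<in> C ` ((\<lambda>e'. {(v, e), (v, e')}) ` (?I v - {e}))"
      then obtain x where "x \<in> ?I v" "x \<noteq> e" "C (matching_edge X e) = C {(v, e), (v, x)}" by auto
      then show False using col[of v e x] p C1[OF I[OF p(3)]] C2[of e x v] by auto
    qed
    ultimately show "inj_on C (incident_edges ?T p)"
      unfolding p(1) incident_edges_complete_truncation[OF p(2,3)] by (auto simp: inj_on_insert)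
  qed
  then show ?thesis by blast
qed

end

theorem theorem4p1:
  fixes X :: "('v, 'e) mgraph"
  assumes "multigraph X"
    and "no_isolated_vertices X"
  shows "class_I (complete_truncation X) \<longleftrightarrow>
    even (max_valency X) \<or> (odd (max_valency X) \<and> edge_feasible X)"
proof -
  interpret multigraph X by (rule assms(1))
  interpret T: multigraph "complete_truncation X" by (rule multigraph_complete_truncation)
  define n where "n = max_valency X"
  have class_iff: "class_I (complete_truncation X) \<longleftrightarrow> (\<exists>C. proper_edge_coloring (complete_truncation X) n C)"
    using T.class_I_iff max_valency_complete_truncation[OF assms(2)] by (simp add: n_def)
  have le: "valency X v \<le> n" if "v \<in> verts X" for v
    using valency_le_max_valency that by (simp add: n_def)
  have "edge_feasible X" if C: "proper_edge_coloring (complete_truncation X) n C" and "odd n" for C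
  proof -
    have "edge_coloring X n (\<lambda>e. C (matching_edge X e))"
      using C by (auto simp: proper_edge_coloring_def edge_coloring_def edges_complete_truncation)
    then show ?thesis
      unfolding edge_feasible_def n_def[symmetric]
      using inj_on_matching_coloring[OF C] \<open>odd n\<close> by blast
  qed
  moreover have "\<exists>C. proper_edge_coloring (complete_truncation X) n C" if "even n"
  proof (rule proper_edge_coloring_complete_truncation)
    show "(\<lambda>_. 0) \<in> edges X \<rightarrow> {..<n}"
    proof
      fix e assume e: "e \<in> edges X"
      then obtain v where v: "v \<in> ends X e" using card_ends by fastforce
      then have "e \<in> incident_edges X v" using e by (simp add: incident_edges_def)
      \<comment> \<open>Color 0 is admissible only if \<open>n > 0\<close>, which the presence of an
        edge guarantees.\<close>
      then have "valency X v > 0"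
        using finite_incident_edges by (auto simp: valency_def card_gt_0_iff)
      then show "0 \<in> {..<n}" using le[of v] v ends_subset[OF e] by force
    qed
    show "valency X v < n \<or> valency X v = n \<and> odd n \<and> inj_on (\<lambda>_. 0) (incident_edges X v) \<or>
        valency X v = n \<and> even n \<and> (\<lambda>_. 0) ` incident_edges X v \<subseteq> {0}" if "v \<in> verts X" for v
      using le[OF that] \<open>even n\<close> by auto
  qed
  moreover have "\<exists>C. proper_edge_coloring (complete_truncation X) n C" if feas: "edge_feasible X"
  proof -
    obtain c where c: "odd n" "edge_coloring X n c"
      "\<And>v. \<lbrakk>v \<in> verts X; valency X v = n\<rbrakk> \<Longrightarrow> inj_on c (incident_edges X v)"
      using feas by (auto simp: edge_feasible_def n_def)
    show ?thesis
    proof (rule proper_edge_coloring_complete_truncation)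
      show "c \<in> edges X \<rightarrow> {..<n}" using c(2) by (simp add: edge_coloring_def)
      show "valency X v < n \<or> valency X v = n \<and> odd n \<and> inj_on c (incident_edges X v) \<or>
          valency X v = n \<and> even n \<and> c ` incident_edges X v \<subseteq> {0}" if "v \<in> verts X" for v
        using le[OF that] c(1,3) that by (auto simp: less_le)
    qed
  qed
  ultimately show ?thesis
    unfolding class_iff n_def[symmetric] by blast
qed

end
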